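(* Let $\boldsymbol\alpha=(\alpha_1,\alpha_2,\alpha_3)\in\mathbb C^3$. The kernel $K_{\boldsymbol\alpha}$ is integrable on $S\times S\times S$ (with respect to $d\sigma\otimes d\sigma\otimes d\sigma$) if and only if $$\Re\alpha_j>-\rho\quad (j=1,2,3)\qquad\text{and}\qquad \Re\alpha_1+\Re\alpha_2+\Re\alpha_3>-\rho .$$
   Context: Let $n\ge 3$, $S=\{x\in\mathbb R^n:|x|=1\}$ the unit sphere, $\rho=\frac{n-1}{2}$, and $d\sigma$ the Lebesgue (Euclidean surface) measure on $S$. For $\boldsymbol\alpha\in\mathbb C^3$, $$K_{\boldsymbol\alpha}(x_1,x_2,x_3)=|x_2-x_3|^{-\rho+\alpha_1}\,|x_3-x_1|^{-\rho+\alpha_2}\,|x_1-x_2|^{-\rho+\alpha_3}.$$ *)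

theory Defs
  imports "HOL-Analysis.Analysis"
begin

text \<open>
  The Euclidean surface measure on the unit sphere, as a Borel measure whose space is the
  sphere. It is given by the polar-coordinates formula: the surface measure of a Borel set
  \<open>A\<close> of unit vectors is the dimension times the Lebesgue measure of the cone
  \<open>{r x | 0 < r < 1, x \<in> A}\<close> (see \<open>emeasure_sphere_measure\<close> below). The radial
  projection onto the sphere is \<open>sgn x = x / |x|\<close>.
\<close>

definition sphere_measure :: "'a::euclidean_space measure" where
  "sphere_measure =
     scale_measure (of_nat DIM('a))
       (distr (restrict_space lborel (ball 0 1 - {0})) (restrict_space borel (sphere 0 1)) sgn)"

lemma space_sphere_measure [simp]:
  "space (sphere_measure :: 'a::euclidean_space measure) = sphere 0 1"
  by (simp add: sphere_measure_def space_scale_measure space_restrict_space)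

lemma sets_sphere_measure [simp, measurable_cong]:
  "sets (sphere_measure :: 'a::euclidean_space measure) =
   sets (restrict_space borel (sphere 0 1))"
  by (simp add: sphere_measure_def)

lemma emeasure_sphere_measure:
  fixes A :: "'a::euclidean_space set"
  assumes "A \<in> sets borel" "A \<subseteq> sphere 0 1"
  shows "emeasure sphere_measure A =
           of_nat DIM('a) * emeasure lborel {r *\<^sub>R x | r x. 0 < r \<and> r < 1 \<and> x \<in> A}"
proof -
  have m: "sgn \<in> measurable (restrict_space lborel (ball 0 1 - {0 :: 'a}))
                   (restrict_space borel (sphere 0 1))"
  proof (rule measurable_restrict_space2)
    show "sgn \<in> space (restrict_space lborel (ball 0 1 - {0 :: 'a})) \<rightarrow> sphere 0 1"
      by (auto simp: space_restrict_space norm_sgn)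
    have "(\<lambda>x::'a. x /\<^sub>R norm x) \<in> borel_measurable borel"
      by measurable
    then have "(sgn :: 'a \<Rightarrow> 'a) \<in> borel_measurable borel"
      by (simp add: sgn_div_norm[abs_def])
    then show "sgn \<in> borel_measurable (restrict_space lborel (ball 0 1 - {0 :: 'a}))"
      by (intro measurable_restrict_space1) simp
  qed
  have A: "A \<in> sets (restrict_space borel (sphere 0 1))"
    using assms by (auto simp: sets_restrict_space)
  have eq: "sgn -` A \<inter> (ball 0 1 - {0}) = {r *\<^sub>R x | r x. 0 < r \<and> r < 1 \<and> x \<in> A}"
  proof (intro equalityI subsetI)
    fix y assume y: "y \<in> sgn -` A \<inter> (ball 0 1 - {0})"
    then have "y = norm y *\<^sub>R sgn y" "0 < norm y" "norm y < 1" "sgn y \<in> A"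
      by (auto simp: sgn_div_norm)
    then show "y \<in> {r *\<^sub>R x | r x. 0 < r \<and> r < 1 \<and> x \<in> A}"
      by blast
  next
    fix y assume "y \<in> {r *\<^sub>R x | r x. 0 < r \<and> r < 1 \<and> x \<in> A}"
    then obtain r x where rx: "y = r *\<^sub>R x" "0 < r" "r < 1" "x \<in> A"
      by blast
    then have "norm x = 1"
      using assms(2) by auto
    with rx show "y \<in> sgn -` A \<inter> (ball 0 1 - {0})"
      by (auto simp: sgn_div_norm)
  qed
  have sub: "{r *\<^sub>R x | r x. 0 < r \<and> r < 1 \<and> x \<in> A} \<subseteq> ball 0 1 - {0}"
    using eq by blast
  show ?thesis
    using m A sub
    by (simp add: sphere_measure_def emeasure_distr space_restrict_space eq
        emeasure_restrict_space)
qed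

definition sphere_rho :: "'a::euclidean_space itself \<Rightarrow> real" where
  "sphere_rho _ = (real DIM('a) - 1) / 2"

text \<open>
  The powers have complex exponents. On the diagonals, where the kernel is undefined or singular,
  the convention \<open>0 powr z = 0\<close> gives it the value 0; the diagonals are null sets.
\<close>

definition sphere_kernel ::
  "complex ^ 3 \<Rightarrow> 'a::euclidean_space \<Rightarrow> 'a \<Rightarrow> 'a \<Rightarrow> complex" where
  "sphere_kernel \<alpha> x\<^sub>1 x\<^sub>2 x\<^sub>3 =
     (let \<rho> = complex_of_real (sphere_rho TYPE('a)) in
        complex_of_real (norm (x\<^sub>2 - x\<^sub>3)) powr (- \<rho> + \<alpha> $ 1) *
        complex_of_real (norm (x\<^sub>3 - x\<^sub>1)) powr (- \<rho> + \<alpha> $ 2) *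
        complex_of_real (norm (x\<^sub>1 - x\<^sub>2)) powr (- \<rho> + \<alpha> $ 3))"

end

theory Submission
  imports Defs
begin

text \<open>
  Let \<open>d = n - 1 = 2\<rho>\<close> and \<open>a\<^sub>j = - \<rho> + Re \<alpha>\<^sub>j\<close>, so that the kernel has absolute value
  \<open>|y - z|\<close> to the \<open>a\<^sub>1\<close>, times \<open>|z - x|\<close> to the \<open>a\<^sub>2\<close>, times \<open>|x - y|\<close> to the \<open>a\<^sub>3\<close>.
  In these terms the condition reads \<open>a\<^sub>j > - d\<close> for each \<open>j\<close> and \<open>a\<^sub>1 + a\<^sub>2 + a\<^sub>3 > - 2 d\<close>: the first part
  governs the collision of two points, the second one the collision of all three.

  The only geometric input is that the surface measure is Ahlfors regular of dimension \<open>d\<close>: caps of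
  radius \<open>r\<close> have measure comparable to \<open>r\<close> to the \<open>d\<close>. Everything else works for any
  such finite measure on a separable metric space, the locale \<open>ahlfors_regular\<close>.
  Cutting a ball of radius \<open>R\<close> into geometric shells shows that the integral of \<open>|x - z|\<close> to the
  \<open>p\<close> over it is comparable to \<open>R\<close> to the \<open>p + d\<close> if \<open>p > - d\<close>, and infinite otherwise
  (\<open>ball_integral_upper\<close>, \<open>ball_integral_lower\<close>, \<open>ball_integral_eq_top\<close>).

  In a triangle one of the three sides is the shortest, and the two others are then
  comparable by the triangle inequality. If the shortest side is \<open>|x - z|\<close>, the kernel is therefore
  comparable to \<open>|x - z|\<close> to the \<open>a\<^sub>2\<close> times \<open>|x - y|\<close> to the \<open>a\<^sub>1 + a\<^sub>3\<close>. Integrating this over \<open>z\<close>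
  with \<open>|x - z|\<close> at most a multiple of \<open>|x - y|\<close> gives infinity if \<open>a\<^sub>2 \<le> - d\<close>, and otherwise \<open>|x - y|\<close> to the
  \<open>a\<^sub>1 + a\<^sub>2 + a\<^sub>3 + d\<close>, whose integral over \<open>y\<close> is finite exactly when \<open>a\<^sub>1 + a\<^sub>2 + a\<^sub>3 > - 2 d\<close>.
  Sufficiency adds the three such bounds (\<open>triple_integral_le_pivot\<close>); necessity uses the matching
  lower bound for a single side and the symmetry of the problem (\<open>triple_integral_ge_pivot\<close>).

  Ahlfors regularity of the sphere follows by thickening a cap of radius \<open>r\<close> radially to the annulus
  \<open>1 \<le> |y| < 1 + r\<close>. By homogeneity of Lebesgue measure the result has volume comparable to \<open>r\<close> times
  the measure of the cap; it contains a ball and lies in another one, both of radius comparable to \<open>r\<close>.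
\<close>

section \<open>Powers of comparable numbers, and the kernels\<close>

lemma powr_shell_bounds:
  fixes t r e p :: real
  assumes "0 < e" "e \<le> 1" "0 < r" "e * r \<le> t" "t \<le> r"
  shows "min 1 (e powr p) * r powr p \<le> t powr p"
    and "t powr p \<le> max 1 (e powr p) * r powr p"
proof -
  have t: "0 < t" using assms by (meson less_le_trans mult_pos_pos)
  have er: "(e * r) powr p = e powr p * r powr p" using assms by (simp add: powr_mult)
  have "t powr p \<le> r powr p \<and> e powr p * r powr p \<le> t powr p
      \<or> r powr p \<le> t powr p \<and> t powr p \<le> e powr p * r powr p"
  proof (cases "p \<ge> 0")
    case True
    then show ?thesis
      unfolding er[symmetric] using t assms by (intro disjI1 conjI powr_mono2) auto
  next
    case False
    then show ?thesis
      unfolding er[symmetric] using t assms by (intro disjI2 conjI powr_mono2') auto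
  qed
  moreover have "min 1 (e powr p) * r powr p \<le> 1 * r powr p"
    "min 1 (e powr p) * r powr p \<le> e powr p * r powr p"
    "1 * r powr p \<le> max 1 (e powr p) * r powr p"
    "e powr p * r powr p \<le> max 1 (e powr p) * r powr p"
    by (intro mult_right_mono; simp)+
  ultimately show "min 1 (e powr p) * r powr p \<le> t powr p"
    and "t powr p \<le> max 1 (e powr p) * r powr p"
    by linarith+
qed

text \<open>
  Here and in the next lemma the constant is the one for the shell with outer radius \<open>2 w\<close> and
  ratio \<open>1 / 4\<close>, which does not depend on \<open>w\<close>.
\<close>

lemma comparable_powr_lower:
  obtains k :: real where "0 < k"
    "\<And>u w. 0 \<le> w \<Longrightarrow> w / 2 \<le> u \<Longrightarrow> u \<le> 2 * w \<Longrightarrow> k * w powr p \<le> u powr p"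
proof
  let ?k = "min 1 ((1 / 4) powr p) * 2 powr p"
  show "0 < ?k" by simp
  fix u w :: real assume "0 \<le> w" "w / 2 \<le> u" "u \<le> 2 * w"
  then show "?k * w powr p \<le> u powr p"
    using powr_shell_bounds(1)[of "1 / 4" "2 * w" u p] by (cases "w = 0") (auto simp: powr_mult mult_ac)
qed

lemma comparable_powr_upper:
  obtains K :: real where "0 < K"
    "\<And>u w. 0 \<le> w \<Longrightarrow> w / 2 \<le> u \<Longrightarrow> u \<le> 2 * w \<Longrightarrow> u powr p \<le> K * w powr p"
proof
  let ?K = "max 1 ((1 / 4) powr p) * 2 powr p"
  show "0 < ?K" by (simp add: less_max_iff_disj)
  fix u w :: real assume "0 \<le> w" "w / 2 \<le> u" "u \<le> 2 * w"
  then show "u powr p \<le> ?K * w powr p"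
    using powr_shell_bounds(2)[of "1 / 4" "2 * w" u p] by (cases "w = 0") (auto simp: powr_mult mult_ac)
qed

lemma geometric_shell_exists:
  fixes e t R :: real
  assumes "0 < e" "e < 1" "0 < t" "t < R"
  shows "\<exists>k. e * (e ^ k * R) \<le> t \<and> t < e ^ k * R"
proof -
  have "\<exists>n. e ^ n * R \<le> t"
  proof -
    obtain n where "e ^ n < t / R" using real_arch_pow_inv[of "t / R" e] assms by auto
    then show ?thesis using assms by (intro exI[of _ n]) (simp add: field_simps)
  qed
  then obtain n where n: "e ^ n * R \<le> t" "\<And>m. m < n \<Longrightarrow> \<not> e ^ m * R \<le> t"
    using exists_least_iff[of "\<lambda>n. e ^ n * R \<le> t"] by auto
  then obtain k where "n = Suc k" using assms by (cases n) auto
  then show ?thesis using n(1) n(2)[of k] by (intro exI[of _ k]) (auto simp: mult.assoc)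
qed

definition triple_kernel :: "real \<Rightarrow> real \<Rightarrow> real \<Rightarrow> 'a::metric_space \<Rightarrow> 'a \<Rightarrow> 'a \<Rightarrow> real" where
  "triple_kernel a1 a2 a3 x y z = dist y z powr a1 * dist z x powr a2 * dist x y powr a3"

text \<open>
  The model for the triple kernel where \<open>|x - z|\<close> is small compared with \<open>|x - y|\<close>: the power of the
  third side has been absorbed into the exponent \<open>q\<close>. The pivot is the point \<open>x\<close> shared by the two sides that remain.
\<close>

definition pivot_kernel :: "real \<Rightarrow> real \<Rightarrow> real \<Rightarrow> 'a::metric_space \<Rightarrow> 'a \<Rightarrow> 'a \<Rightarrow> ennreal" where
  "pivot_kernel l p q x y z =
     ennreal (dist x y powr q) * (ennreal (dist x z powr p) * indicator {..<l * dist x y} (dist x z))"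

section \<open>Ahlfors regular measures\<close>

text \<open>
  Regularity from below can only be asked up to the diameter, of which \<open>D\<close> is a bound; the bound from above
  holds at every scale once it holds up to the diameter.
\<close>

locale ahlfors_regular = finite_measure M
  for M :: "'a::{metric_space, second_countable_topology} measure" +
  fixes c C d D :: real
  \<comment> \<open>The measure may live on a subset of the type, with the trace of the Borel sets or a larger \<open>\<sigma>\<close>-algebra.\<close>
  assumes ident_measurable: "(\<lambda>x. x) \<in> borel_measurable M"
    and nonempty: "space M \<noteq> {}"
    and pos: "0 < c" "0 < C" "0 < d" "0 < D"
    and dist_le: "x \<in> space M \<Longrightarrow> y \<in> space M \<Longrightarrow> dist x y \<le> D"
    and ball_upper: "x \<in> space M \<Longrightarrow> 0 < r \<Longrightarrow> measure M {z \<in> space M. dist x z < r} \<le> C * r powr d"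
    and ball_lower: "x \<in> space M \<Longrightarrow> 0 < r \<Longrightarrow> r \<le> D \<Longrightarrow>
      c * r powr d \<le> measure M {z \<in> space M. dist x z < r}"
begin

lemma dist_measurable [measurable (raw)]:
  assumes "f \<in> measurable N M" "g \<in> measurable N M"
  shows "(\<lambda>w. dist (f w) (g w)) \<in> borel_measurable N"
  using measurable_compose[OF assms(1) ident_measurable] measurable_compose[OF assms(2) ident_measurable]
  by measurable

definition shell :: "'a \<Rightarrow> real \<Rightarrow> real \<Rightarrow> 'a set" where
  "shell x s r = {z \<in> space M. s \<le> dist x z \<and> dist x z < r}"

lemma shell_sets [measurable]: "x \<in> space M \<Longrightarrow> shell x s r \<in> sets M"
  unfolding shell_def by measurable

text \<open>
  As the ratio between the inner and outer radius of a shell it is so small that the inner ball carries at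
  most half of the guaranteed measure of the outer ball, so that every shell has its full share of measure.
\<close>

definition ratio :: real where
  "ratio = min (1 / 2) ((c / (2 * C)) powr (1 / d))"

lemma ratio: "0 < ratio" "ratio < 1" "C * ratio powr d \<le> c / 2"
proof -
  have "ratio powr d \<le> ((c / (2 * C)) powr (1 / d)) powr d"
    unfolding ratio_def using pos by (intro powr_mono2) auto
  also have "\<dots> = c / (2 * C)" using pos by (simp add: powr_powr)
  finally show "C * ratio powr d \<le> c / 2" using pos by (simp add: field_simps)
qed (use pos in \<open>auto simp: ratio_def\<close>)

lemma measure_shell_upper:
  assumes "x \<in> space M" "0 < r"
  shows "measure M (shell x s r) \<le> C * r powr d"
proof -
  have "measure M (shell x s r) \<le> measure M {z \<in> space M. dist x z < r}"
    by (intro finite_measure_mono) (use assms in \<open>auto simp: shell_def\<close>)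
  then show ?thesis using ball_upper[OF assms] by linarith
qed

lemma measure_shell_lower:
  assumes "x \<in> space M" "0 < r" "r \<le> D"
  shows "c / 2 * r powr d \<le> measure M (shell x (ratio * r) r)"
proof -
  let ?B = "\<lambda>r. {z \<in> space M. dist x z < r}"
  have "ratio * r \<le> r" using ratio assms by simp
  then have "?B (ratio * r) \<subseteq> ?B r" by auto
  moreover have "shell x (ratio * r) r = ?B r - ?B (ratio * r)" by (auto simp: shell_def)
  moreover have "?B r \<in> sets M" "?B (ratio * r) \<in> sets M" using assms(1) by measurable
  ultimately have "measure M (shell x (ratio * r) r) = measure M (?B r) - measure M (?B (ratio * r))"
    by (simp add: finite_measure_Diff)
  moreover have "measure M (?B (ratio * r)) \<le> C * (ratio * r) powr d"
    using ball_upper[of x "ratio * r"] assms ratio by simp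
  moreover have "C * (ratio * r) powr d \<le> c / 2 * r powr d"
    using ratio assms mult_right_mono[OF ratio(3), of "r powr d"] by (simp add: powr_mult mult_ac)
  ultimately show ?thesis using ball_lower[OF assms] by linarith
qed

section \<open>Integrals of powers of the distance over balls\<close>

lemma shell_integral_upper:
  obtains K where "0 < K" "\<And>x r. x \<in> space M \<Longrightarrow> 0 < r \<Longrightarrow>
    (\<integral>\<^sup>+z\<in>shell x (ratio * r) r. ennreal (dist x z powr p) \<partial>M) \<le> ennreal (K * r powr (p + d))"
proof
  let ?m = "max 1 (ratio powr p)"
  show "0 < ?m * C" using pos by (simp add: less_max_iff_disj)
  fix x r assume x: "x \<in> space M" and r: "0 < (r::real)"
  have "(\<integral>\<^sup>+z\<in>shell x (ratio * r) r. ennreal (dist x z powr p) \<partial>M)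
      \<le> (\<integral>\<^sup>+z. ennreal (?m * r powr p) * indicator (shell x (ratio * r) r) z \<partial>M)"
    using ratio r
    by (intro nn_integral_mono)
       (auto simp: shell_def indicator_def intro!: ennreal_leI powr_shell_bounds(2)[of ratio])
  also have "\<dots> = ennreal (?m * r powr p) * ennreal (measure M (shell x (ratio * r) r))"
    using x by (simp add: nn_integral_cmult_indicator emeasure_eq_measure)
  also have "\<dots> \<le> ennreal (?m * r powr p) * ennreal (C * r powr d)"
    by (intro mult_left_mono ennreal_leI measure_shell_upper x r) auto
  also have "\<dots> = ennreal (?m * C * r powr (p + d))"
    using pos by (subst ennreal_mult''[symmetric]) (auto simp: powr_add mult_ac)
  finally show "(\<integral>\<^sup>+z\<in>shell x (ratio * r) r. ennreal (dist x z powr p) \<partial>M)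
      \<le> ennreal (?m * C * r powr (p + d))" .
qed

lemma shell_integral_lower:
  obtains k where "0 < k" "\<And>x r. x \<in> space M \<Longrightarrow> 0 < r \<Longrightarrow> r \<le> D \<Longrightarrow>
    ennreal (k * r powr (p + d)) \<le> (\<integral>\<^sup>+z\<in>shell x (ratio * r) r. ennreal (dist x z powr p) \<partial>M)"
proof
  let ?m = "min 1 (ratio powr p)"
  show "0 < ?m * (c / 2)" using pos ratio by simp
  fix x r assume x: "x \<in> space M" and r: "0 < (r::real)" "r \<le> D"
  have m: "0 \<le> ?m" by simp
  have "ennreal (?m * (c / 2) * r powr (p + d)) = ennreal (?m * r powr p) * ennreal (c / 2 * r powr d)"
    using pos m by (subst ennreal_mult''[symmetric]) (auto simp: powr_add mult_ac)
  also have "\<dots> \<le> ennreal (?m * r powr p) * ennreal (measure M (shell x (ratio * r) r))"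
    by (intro mult_left_mono ennreal_leI measure_shell_lower x r) auto
  also have "\<dots> = (\<integral>\<^sup>+z. ennreal (?m * r powr p) * indicator (shell x (ratio * r) r) z \<partial>M)"
    using x by (simp add: nn_integral_cmult_indicator emeasure_eq_measure)
  also have "\<dots> \<le> (\<integral>\<^sup>+z\<in>shell x (ratio * r) r. ennreal (dist x z powr p) \<partial>M)"
    using ratio r
    by (intro nn_integral_mono)
       (auto simp: shell_def indicator_def intro!: ennreal_leI powr_shell_bounds(1)[of ratio])
  finally show "ennreal (?m * (c / 2) * r powr (p + d))
      \<le> (\<integral>\<^sup>+z\<in>shell x (ratio * r) r. ennreal (dist x z powr p) \<partial>M)" .
qed

definition ball_integral :: "'a \<Rightarrow> real \<Rightarrow> real \<Rightarrow> ennreal" where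
  "ball_integral x p R = (\<integral>\<^sup>+z. ennreal (dist x z powr p) * indicator {..<R} (dist x z) \<partial>M)"

text \<open>
  The shells with outer radii \<open>ratio\<close> to the \<open>k\<close> times \<open>R\<close> fill the ball except for its centre, where the integrand is
  \<open>0 powr p = 0\<close>.
\<close>

lemma ball_integral_eq_suminf:
  assumes x: "x \<in> space M" and R: "0 < R"
  shows "ball_integral x p R =
    (\<Sum>k. \<integral>\<^sup>+z\<in>shell x (ratio * (ratio ^ k * R)) (ratio ^ k * R). ennreal (dist x z powr p) \<partial>M)"
proof -
  let ?S = "\<lambda>k. shell x (ratio * (ratio ^ k * R)) (ratio ^ k * R)"
  have le: "ratio ^ n * R \<le> ratio * (ratio ^ m * R)" if "m < n" for m n
  proof -
    have "ratio ^ n \<le> ratio ^ Suc m" using ratio that by (intro power_decreasing) auto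
    then show ?thesis using R by (simp add: mult.assoc)
  qed
  have disj: "disjoint_family ?S"
    unfolding disjoint_family_on_def
  proof (intro ballI impI)
    fix m n :: nat assume "m \<noteq> n"
    then consider "m < n" | "n < m" by linarith
    then show "?S m \<inter> ?S n = {}"
      using le[of m n] le[of n m] by cases (auto simp: shell_def)
  qed
  have le_R: "ratio ^ k * R \<le> R" for k
    using ratio R by (simp add: power_le_one)
  have "ball_integral x p R = (\<integral>\<^sup>+z\<in>(\<Union>k. ?S k). ennreal (dist x z powr p) \<partial>M)"
    unfolding ball_integral_def
  proof (intro nn_integral_cong)
    fix z assume z: "z \<in> space M"
    show "ennreal (dist x z powr p) * indicator {..<R} (dist x z)
        = ennreal (dist x z powr p) * indicator (\<Union>k. ?S k) z"
    proof (cases "dist x z = 0 \<or> R \<le> dist x z")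
      case True
      have "dist x z < R" if "dist x z < ratio ^ k * R" for k using le_R[of k] that by linarith
      with True show ?thesis by (auto simp: shell_def indicator_def)
    next
      case False
      then have "0 < dist x z" "dist x z < R" by auto
      from geometric_shell_exists[OF ratio(1,2) this] z False
      have "z \<in> (\<Union>k. ?S k)" by (auto simp: shell_def)
      with False show ?thesis by (simp add: indicator_def)
    qed
  qed
  also have "\<dots> = (\<Sum>k. \<integral>\<^sup>+z\<in>?S k. ennreal (dist x z powr p) \<partial>M)"
    using disj x by (intro nn_integral_disjoint_family) auto
  finally show ?thesis .
qed

text \<open>
  The shell integrals are dominated by a geometric series with quotient \<open>ratio powr (p + d)\<close>, which is less than 1.
\<close>

lemma ball_integral_upper:
  assumes p: "- d < p"
  obtains K where "0 < K" "\<And>x R. x \<in> space M \<Longrightarrow> 0 \<le> R \<Longrightarrow>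
    ball_integral x p R \<le> ennreal (K * R powr (p + d))"
proof -
  obtain K where K: "0 < K" "\<And>x r. x \<in> space M \<Longrightarrow> 0 < r \<Longrightarrow>
    (\<integral>\<^sup>+z\<in>shell x (ratio * r) r. ennreal (dist x z powr p) \<partial>M) \<le> ennreal (K * r powr (p + d))"
    using shell_integral_upper by blast
  define q where "q = ratio powr (p + d)"
  have q: "0 < q" "q < 1"
    using ratio p powr_less_mono2[of "p + d" ratio 1] by (auto simp: q_def)
  show ?thesis
  proof
    show "0 < K / (1 - q)" using K q by simp
    fix x R assume x: "x \<in> space M" and R0: "0 \<le> (R::real)"
    show "ball_integral x p R \<le> ennreal (K / (1 - q) * R powr (p + d))"
    proof (cases "R = 0")
      case True
      then show ?thesis by (simp add: ball_integral_def indicator_def)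
    next
      case False
      with R0 have R: "0 < R" by simp
      have pk: "(ratio ^ k * R) powr (p + d) = q ^ k * R powr (p + d)" for k
        using ratio R by (simp add: powr_mult q_def powr_powr flip: powr_realpow) (simp add: mult.commute)
      have "ball_integral x p R \<le> (\<Sum>k. ennreal (K * (ratio ^ k * R) powr (p + d)))"
        unfolding ball_integral_eq_suminf[OF x R]
        using K(2) x R ratio by (intro suminf_le) auto
      also have "\<dots> = ennreal (\<Sum>k. K * (ratio ^ k * R) powr (p + d))"
        unfolding pk using q K by (intro suminf_ennreal2 summable_mult summable_mult2 summable_geometric) auto
      also have "(\<Sum>k. K * (ratio ^ k * R) powr (p + d)) = (\<Sum>k. (K * R powr (p + d)) * q ^ k)"
        unfolding pk by (simp add: mult_ac)
      also have "\<dots> = (K * R powr (p + d)) * (1 / (1 - q))"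
        using q by (subst suminf_mult) (auto simp: suminf_geometric summable_geometric)
      also have "\<dots> = K / (1 - q) * R powr (p + d)" by simp
      finally show ?thesis .
    qed
  qed
qed

text \<open>
  The outermost shell alone gives the right order of magnitude.
\<close>

lemma ball_integral_lower:
  obtains k where "0 < k" "\<And>x R. x \<in> space M \<Longrightarrow> 0 \<le> R \<Longrightarrow> R \<le> D \<Longrightarrow>
    ennreal (k * R powr (p + d)) \<le> ball_integral x p R"
proof -
  obtain k where k: "0 < k" "\<And>x r. x \<in> space M \<Longrightarrow> 0 < r \<Longrightarrow> r \<le> D \<Longrightarrow>
    ennreal (k * r powr (p + d)) \<le> (\<integral>\<^sup>+z\<in>shell x (ratio * r) r. ennreal (dist x z powr p) \<partial>M)"
    using shell_integral_lower by blast
  have "ennreal (k * R powr (p + d)) \<le> ball_integral x p R"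
    if x: "x \<in> space M" and R: "0 \<le> R" "R \<le> D" for x R
  proof (cases "R = 0")
    case False
    then have "ennreal (k * R powr (p + d)) \<le> (\<integral>\<^sup>+z\<in>shell x (ratio * R) R. ennreal (dist x z powr p) \<partial>M)"
      using k x R by simp
    also have "\<dots> \<le> ball_integral x p R"
      unfolding ball_integral_def by (intro nn_integral_mono) (auto simp: shell_def indicator_def)
    finally show ?thesis .
  qed simp
  with k(1) that show ?thesis by blast
qed

text \<open>
  For \<open>p + d \<le> 0\<close> the shell integrals do not decrease below a positive constant as the shells shrink,
  and there are infinitely many of them.
\<close>

lemma ball_integral_eq_top:
  assumes p: "p \<le> - d" and x: "x \<in> space M" and R: "0 < R" "R \<le> D"
  shows "ball_integral x p R = \<infinity>"
proof -
  obtain k where k: "0 < k" "\<And>x r. x \<in> space M \<Longrightarrow> 0 < r \<Longrightarrow> r \<le> D \<Longrightarrow>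
    ennreal (k * r powr (p + d)) \<le> (\<integral>\<^sup>+z\<in>shell x (ratio * r) r. ennreal (dist x z powr p) \<partial>M)"
    using shell_integral_lower by blast
  have "ennreal (k * R powr (p + d))
      \<le> (\<integral>\<^sup>+z\<in>shell x (ratio * (ratio ^ j * R)) (ratio ^ j * R). ennreal (dist x z powr p) \<partial>M)" for j
  proof -
    have le: "ratio ^ j * R \<le> R" "0 < ratio ^ j * R" using ratio R by (auto simp: power_le_one)
    then have "R powr (p + d) \<le> (ratio ^ j * R) powr (p + d)"
      using p by (intro powr_mono2') auto
    moreover have "ratio ^ j * R \<le> D" using le R by linarith
    ultimately show ?thesis
      using k(1) le by (intro order_trans[OF _ k(2)] ennreal_leI) (auto simp: x)
  qed
  then have "(\<Sum>j::nat. ennreal (k * R powr (p + d))) \<le> ball_integral x p R"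
    unfolding ball_integral_eq_suminf[OF x R(1)] by (intro suminf_le) auto
  moreover have "(\<Sum>j::nat. ennreal (k * R powr (p + d))) = \<infinity>"
    using k(1) R by (simp add: ennreal_mult_top flip: nn_integral_count_space_nat)
  ultimately show ?thesis by (simp add: top_unique)
qed

lemma emeasure_space_pos: "0 < emeasure M (space M)"
proof -
  obtain x where x: "x \<in> space M" using nonempty by blast
  have "0 < c * D powr d" using pos by simp
  also have "\<dots> \<le> measure M {z \<in> space M. dist x z < D}" using ball_lower x pos by simp
  also have "\<dots> \<le> measure M (space M)" by (rule bounded_measure)
  finally show ?thesis by (simp add: emeasure_eq_measure)
qed

lemma nn_integral_dist_powr_ge:
  "ball_integral x q R \<le> (\<integral>\<^sup>+y. ennreal (dist x y powr q) \<partial>M)"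
  unfolding ball_integral_def by (intro nn_integral_mono) (auto simp: indicator_def)

lemma nn_integral_dist_powr_eq:
  assumes "x \<in> space M"
  shows "(\<integral>\<^sup>+y. ennreal (dist x y powr q) \<partial>M) = ball_integral x q (D + 1)"
  unfolding ball_integral_def
proof (intro nn_integral_cong)
  fix y assume "y \<in> space M"
  with assms have "dist x y \<in> {..<D + 1}" using dist_le[of x y] by simp
  then show "ennreal (dist x y powr q)
    = ennreal (dist x y powr q) * indicator {..<D + 1} (dist x y)" by simp
qed

section \<open>Integrals with one short side\<close>

lemma pivot_kernel_measurable [measurable (raw)]:
  assumes [measurable]: "f \<in> measurable N M" "g \<in> measurable N M" "h \<in> measurable N M"
  shows "(\<lambda>w. pivot_kernel l p q (f w) (g w) (h w)) \<in> borel_measurable N"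
  unfolding pivot_kernel_def indicator_def lessThan_iff by measurable

definition pivot_integral :: "real \<Rightarrow> real \<Rightarrow> real \<Rightarrow> ennreal" where
  "pivot_integral l p q = (\<integral>\<^sup>+x. \<integral>\<^sup>+y. \<integral>\<^sup>+z. pivot_kernel l p q x y z \<partial>M \<partial>M \<partial>M)"

lemma nn_integral_pivot_kernel:
  assumes [measurable]: "x \<in> space M" "y \<in> space M"
  shows "(\<integral>\<^sup>+z. pivot_kernel l p q x y z \<partial>M)
    = ennreal (dist x y powr q) * ball_integral x p (l * dist x y)"
proof -
  have "(\<lambda>z. ennreal (dist x z powr p) * indicator {..<l * dist x y} (dist x z)) \<in> borel_measurable M"
    unfolding indicator_def lessThan_iff by measurable
  then show ?thesis
    unfolding pivot_kernel_def ball_integral_def by (rule nn_integral_cmult)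
qed

text \<open>
  The integral over \<open>z\<close> turns the exponent \<open>q\<close> of \<open>|x - y|\<close> into \<open>p + q + d\<close>, and this exceeds \<open>- d\<close> by assumption.
\<close>

lemma pivot_integral_finite:
  assumes l: "0 < l" and p: "- d < p" and pq: "- 2 * d < p + q"
  shows "pivot_integral l p q < \<infinity>"
proof -
  obtain K where K: "0 < K" "\<And>x R. x \<in> space M \<Longrightarrow> 0 \<le> R \<Longrightarrow>
    ball_integral x p R \<le> ennreal (K * R powr (p + d))"
    using ball_integral_upper[OF p] by blast
  have "- d < p + q + d" using pq by simp
  then obtain L where L: "0 < L" "\<And>x R. x \<in> space M \<Longrightarrow> 0 \<le> R \<Longrightarrow>
    ball_integral x (p + q + d) R \<le> ennreal (L * R powr (p + q + d + d))"
    using ball_integral_upper by blast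
  define A where "A = ennreal (K * l powr (p + d))"
  define B where "B = ennreal (L * (D + 1) powr (p + q + d + d))"
  have "(\<integral>\<^sup>+y. \<integral>\<^sup>+z. pivot_kernel l p q x y z \<partial>M \<partial>M) \<le> A * B" if x[measurable]: "x \<in> space M" for x
  proof -
    have "(\<integral>\<^sup>+y. \<integral>\<^sup>+z. pivot_kernel l p q x y z \<partial>M \<partial>M)
        \<le> (\<integral>\<^sup>+y. A * ennreal (dist x y powr (p + q + d)) \<partial>M)"
    proof (intro nn_integral_mono)
      fix y assume y: "y \<in> space M"
      have "(\<integral>\<^sup>+z. pivot_kernel l p q x y z \<partial>M)
          \<le> ennreal (dist x y powr q) * ennreal (K * (l * dist x y) powr (p + d))"
        unfolding nn_integral_pivot_kernel[OF x y] using l by (intro mult_left_mono K x) auto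
      also have "\<dots> = A * ennreal (dist x y powr (p + q + d))"
        using K(1) l unfolding A_def
        by (simp add: powr_mult powr_add mult_ac flip: ennreal_mult'')
      finally show "(\<integral>\<^sup>+z. pivot_kernel l p q x y z \<partial>M) \<le> A * ennreal (dist x y powr (p + q + d))" .
    qed
    also have "\<dots> = A * ball_integral x (p + q + d) (D + 1)"
      by (subst nn_integral_cmult) (simp_all add: nn_integral_dist_powr_eq[OF x])
    also have "\<dots> \<le> A * B"
      unfolding B_def using pos by (intro mult_left_mono L x) auto
    finally show ?thesis .
  qed
  then have "pivot_integral l p q \<le> (\<integral>\<^sup>+x. A * B \<partial>M)"
    unfolding pivot_integral_def by (intro nn_integral_mono) auto
  also have "\<dots> = A * B * emeasure M (space M)" by simp
  also have "\<dots> < \<infinity>"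
    by (auto simp: A_def B_def emeasure_eq_measure ennreal_mult_less_top)
  finally show ?thesis .
qed

text \<open>
  Already the integral over \<open>y\<close> and \<open>z\<close> is infinite for every \<open>x\<close>. If \<open>p \<le> - d\<close>, the integral over
  \<open>z\<close> is infinite for every \<open>y\<close> other than \<open>x\<close>; otherwise it is at least a multiple of \<open>|x - y|\<close> to the \<open>p + d\<close>,
  and the integral over \<open>y\<close> diverges. The bound \<open>l \<le> 1\<close> keeps the radius \<open>l |x - y|\<close> in the range
  where balls have a guaranteed measure.
\<close>

lemma pivot_integral_eq_top:
  assumes l: "0 < l" "l \<le> 1" and pq: "p \<le> - d \<or> p + q \<le> - 2 * d"
  shows "pivot_integral l p q = \<infinity>"
proof -
  have "(\<integral>\<^sup>+y. \<integral>\<^sup>+z. pivot_kernel l p q x y z \<partial>M \<partial>M) = \<infinity>" if x[measurable]: "x \<in> space M" for x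
  proof (cases "p \<le> - d")
    case True
    obtain k where k: "0 < k" "ennreal (k * D powr (q + d)) \<le> ball_integral x q D"
      using ball_integral_lower[of q] x pos by (metis less_imp_le order_refl)
    have "0 < ennreal (k * D powr (q + d))" using k pos by simp
    also note k(2)
    also note nn_integral_dist_powr_ge
    finally have "\<infinity> = (\<integral>\<^sup>+y. ennreal (dist x y powr q) \<partial>M) * \<infinity>"
      by (simp add: ennreal_mult_top)
    also have "\<dots> = (\<integral>\<^sup>+y. ennreal (dist x y powr q) * \<infinity> \<partial>M)"
      by (subst nn_integral_multc) auto
    also have "\<dots> = (\<integral>\<^sup>+y. \<integral>\<^sup>+z. pivot_kernel l p q x y z \<partial>M \<partial>M)"
    \<comment> \<open>At \<open>y = x\<close> both sides are \<open>0\<close>, because \<open>0 * \<infinity> = 0\<close>.\<close>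
    proof (intro nn_integral_cong)
      fix y assume y: "y \<in> space M"
      show "ennreal (dist x y powr q) * \<infinity> = (\<integral>\<^sup>+z. pivot_kernel l p q x y z \<partial>M)"
      proof (cases "x = y")
        case False
        have "l * dist x y \<le> 1 * D" using l dist_le[OF x y] by (intro mult_mono) auto
        then have "ball_integral x p (l * dist x y) = \<infinity>"
          using False l by (intro ball_integral_eq_top True x) auto
        then show ?thesis by (simp add: nn_integral_pivot_kernel x y)
      qed (simp add: nn_integral_pivot_kernel x y)
    qed
    finally show ?thesis by simp
  next
    case False
    obtain k where k: "0 < k" "\<And>x R. x \<in> space M \<Longrightarrow> 0 \<le> R \<Longrightarrow> R \<le> D \<Longrightarrow>
      ennreal (k * R powr (p + d)) \<le> ball_integral x p R"
      using ball_integral_lower[of p] by blast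
    have "p + q + d \<le> - d" using pq False by linarith
    then have "ball_integral x (p + q + d) D = \<infinity>"
      using x pos by (intro ball_integral_eq_top) auto
    then have "(\<integral>\<^sup>+y. ennreal (dist x y powr (p + q + d)) \<partial>M) = \<infinity>"
      using nn_integral_dist_powr_ge[of x "p + q + d" D] by (simp add: top_unique)
    then have "\<infinity> = ennreal (k * l powr (p + d)) * (\<integral>\<^sup>+y. ennreal (dist x y powr (p + q + d)) \<partial>M)"
      using k l by (simp add: ennreal_mult_top)
    also have "\<dots> = (\<integral>\<^sup>+y. ennreal (k * l powr (p + d)) * ennreal (dist x y powr (p + q + d)) \<partial>M)"
      by (subst nn_integral_cmult) auto
    also have "\<dots> \<le> (\<integral>\<^sup>+y. \<integral>\<^sup>+z. pivot_kernel l p q x y z \<partial>M \<partial>M)"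
    proof (intro nn_integral_mono)
      fix y assume y: "y \<in> space M"
      have "l * dist x y \<le> 1 * D" using l dist_le[OF x y] by (intro mult_mono) auto
      then have "ennreal (dist x y powr q) * ennreal (k * (l * dist x y) powr (p + d))
          \<le> (\<integral>\<^sup>+z. pivot_kernel l p q x y z \<partial>M)"
        unfolding nn_integral_pivot_kernel[OF x y] using l by (intro mult_left_mono k x) auto
      moreover have "ennreal (dist x y powr q) * ennreal (k * (l * dist x y) powr (p + d))
          = ennreal (k * l powr (p + d)) * ennreal (dist x y powr (p + q + d))"
        using k l by (simp add: powr_mult powr_add mult_ac flip: ennreal_mult'')
      ultimately show "ennreal (k * l powr (p + d)) * ennreal (dist x y powr (p + q + d))
          \<le> (\<integral>\<^sup>+z. pivot_kernel l p q x y z \<partial>M)" by simp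
    qed
    finally show ?thesis by (simp add: top_unique)
  qed
  then have "pivot_integral l p q = (\<integral>\<^sup>+x. \<infinity> \<partial>M)"
    unfolding pivot_integral_def by (intro nn_integral_cong) auto
  also have "\<dots> = \<infinity>" using emeasure_space_pos by (simp add: ennreal_top_mult)
  finally show ?thesis .
qed

section \<open>The triple integral over an Ahlfors regular space\<close>

lemma nn_integral_swap12:
  assumes h: "(\<lambda>(x, y, z). h x y z) \<in> borel_measurable (M \<Otimes>\<^sub>M (M \<Otimes>\<^sub>M M))"
  shows "(\<integral>\<^sup>+x. \<integral>\<^sup>+y. \<integral>\<^sup>+z. h x y z \<partial>M \<partial>M \<partial>M) = (\<integral>\<^sup>+x. \<integral>\<^sup>+y. \<integral>\<^sup>+z. h y x z \<partial>M \<partial>M \<partial>M)"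
proof -
  have "(\<lambda>w. (fst (fst w), snd (fst w), snd w)) \<in> measurable ((M \<Otimes>\<^sub>M M) \<Otimes>\<^sub>M M) (M \<Otimes>\<^sub>M (M \<Otimes>\<^sub>M M))"
    by measurable
  from measurable_compose[OF this h]
  have "(\<lambda>((x, y), z). h x y z) \<in> borel_measurable ((M \<Otimes>\<^sub>M M) \<Otimes>\<^sub>M M)"
    by (simp add: case_prod_beta')
  from borel_measurable_nn_integral_fst[OF this]
  have meas: "(\<lambda>(x, y). \<integral>\<^sup>+z. h x y z \<partial>M) \<in> borel_measurable (M \<Otimes>\<^sub>M M)"
    by (simp add: case_prod_beta')
  interpret pair_sigma_finite M M ..
  from meas show ?thesis by (rule Fubini'[symmetric])
qed

lemma nn_integral_swap23:
  assumes h: "(\<lambda>(x, y, z). h x y z) \<in> borel_measurable (M \<Otimes>\<^sub>M (M \<Otimes>\<^sub>M M))"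
  shows "(\<integral>\<^sup>+x. \<integral>\<^sup>+y. \<integral>\<^sup>+z. h x y z \<partial>M \<partial>M \<partial>M) = (\<integral>\<^sup>+x. \<integral>\<^sup>+y. \<integral>\<^sup>+z. h x z y \<partial>M \<partial>M \<partial>M)"
proof (rule nn_integral_cong)
  interpret pair_sigma_finite M M ..
  fix x assume "x \<in> space M"
  then have "(\<lambda>(y, z). h x y z) \<in> borel_measurable (M \<Otimes>\<^sub>M M)"
    using measurable_compose[OF measurable_Pair1' h] by simp
  then show "(\<integral>\<^sup>+y. \<integral>\<^sup>+z. h x y z \<partial>M \<partial>M) = (\<integral>\<^sup>+y. \<integral>\<^sup>+z. h x z y \<partial>M \<partial>M)"
    by (rule Fubini'[symmetric])
qed

lemma triple_kernel_measurable [measurable (raw)]: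
  assumes [measurable]: "f \<in> measurable N M" "g \<in> measurable N M" "h \<in> measurable N M"
  shows "(\<lambda>w. triple_kernel a1 a2 a3 (f w) (g w) (h w)) \<in> borel_measurable N"
  unfolding triple_kernel_def by measurable

definition triple_integral :: "real \<Rightarrow> real \<Rightarrow> real \<Rightarrow> ennreal" where
  "triple_integral a1 a2 a3 = (\<integral>\<^sup>+x. \<integral>\<^sup>+y. \<integral>\<^sup>+z. ennreal (triple_kernel a1 a2 a3 x y z) \<partial>M \<partial>M \<partial>M)"

lemma triple_integral_swap12: "triple_integral a1 a2 a3 = triple_integral a2 a1 a3"
  unfolding triple_integral_def
  by (subst nn_integral_swap12) (simp_all add: triple_kernel_def dist_commute mult_ac)

lemma triple_integral_swap23: "triple_integral a1 a2 a3 = triple_integral a1 a3 a2"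
  unfolding triple_integral_def
  by (subst nn_integral_swap23) (simp_all add: triple_kernel_def dist_commute mult_ac)

text \<open>
  Where \<open>|x - z| < |x - y| / 2\<close>, the third side \<open>|y - z|\<close> lies between \<open>|x - y| / 2\<close> and \<open>2 |x - y|\<close>.
\<close>

lemma triple_integral_ge_pivot:
  obtains k where "0 < k" "ennreal k * pivot_integral (1 / 2) a2 (a1 + a3) \<le> triple_integral a1 a2 a3"
proof -
  obtain k where k: "0 < k"
    "\<And>u w. 0 \<le> w \<Longrightarrow> w / 2 \<le> u \<Longrightarrow> u \<le> 2 * w \<Longrightarrow> k * w powr a1 \<le> u powr a1"
    using comparable_powr_lower by blast
  have ptw: "ennreal k * pivot_kernel (1 / 2) a2 (a1 + a3) x y z \<le> ennreal (triple_kernel a1 a2 a3 x y z)" for x y z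
  proof (cases "dist x z < dist x y / 2")
    case True
    have "k * dist x y powr a1 \<le> dist y z powr a1"
      using True dist_triangle[of x y z] dist_triangle[of y z x]
      by (intro k(2)) (auto simp: dist_commute)
    then have "k * dist x y powr a1 * (dist z x powr a2 * dist x y powr a3)
        \<le> dist y z powr a1 * (dist z x powr a2 * dist x y powr a3)"
      by (intro mult_right_mono) auto
    then have "ennreal (k * dist x y powr a1 * (dist z x powr a2 * dist x y powr a3))
        \<le> ennreal (triple_kernel a1 a2 a3 x y z)"
      by (intro ennreal_leI) (simp add: triple_kernel_def mult_ac)
    moreover have "ennreal k * pivot_kernel (1 / 2) a2 (a1 + a3) x y z
        = ennreal (k * dist x y powr a1 * (dist z x powr a2 * dist x y powr a3))"
      using True k(1)
      by (simp add: pivot_kernel_def powr_add dist_commute mult_ac flip: ennreal_mult'')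
    ultimately show ?thesis by simp
  qed (simp add: pivot_kernel_def)
  have "ennreal k * pivot_integral (1 / 2) a2 (a1 + a3)
      = (\<integral>\<^sup>+x. \<integral>\<^sup>+y. \<integral>\<^sup>+z. ennreal k * pivot_kernel (1 / 2) a2 (a1 + a3) x y z \<partial>M \<partial>M \<partial>M)"
    unfolding pivot_integral_def by (simp add: nn_integral_cmult cong: nn_integral_cong)
  also have "\<dots> \<le> triple_integral a1 a2 a3"
    unfolding triple_integral_def by (intro nn_integral_mono ptw)
  finally show ?thesis using that k(1) by blast
qed

text \<open>
  The three terms belong to the three sides that can be the shortest. Where a side is the shortest, the other two are
  within a factor 2 of each other; so the two of them are merged into one power. Each term needs only one transposition
  of the variables to become a pivot integral. The cut-off \<open>l = 2\<close> admits ties, since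
  the pivot kernel asks for a strict inequality.
\<close>

lemma triple_integral_le_pivot:
  obtains K where "triple_integral a1 a2 a3
    \<le> ennreal K * (pivot_integral 2 a2 (a1 + a3) + pivot_integral 2 a3 (a1 + a2) + pivot_integral 2 a1 (a2 + a3))"
proof -
  obtain A where A: "0 < A"
    "\<And>u w. 0 \<le> w \<Longrightarrow> w / 2 \<le> u \<Longrightarrow> u \<le> 2 * w \<Longrightarrow> u powr a1 \<le> A * w powr a1"
    using comparable_powr_upper by blast
  obtain B where B: "0 < B"
    "\<And>u w. 0 \<le> w \<Longrightarrow> w / 2 \<le> u \<Longrightarrow> u \<le> 2 * w \<Longrightarrow> u powr a2 \<le> B * w powr a2"
    using comparable_powr_upper by blast
  define K where "K = max A B"
  have K: "0 < K" "A \<le> K" "B \<le> K" using A B by (auto simp: K_def)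
  have ptw: "ennreal (triple_kernel a1 a2 a3 x y z) \<le> ennreal K * (pivot_kernel 2 a2 (a1 + a3) x y z
      + pivot_kernel 2 a3 (a1 + a2) x z y + pivot_kernel 2 a1 (a2 + a3) y x z)" (is "_ \<le> _ * (?P + ?Q + ?R)")
    for x y z
  proof (cases "x = y \<or> y = z \<or> z = x")
    case True
    then show ?thesis by (auto simp: triple_kernel_def)
  next
    case False
    \<comment> \<open>The sides opposite to \<open>x\<close>, \<open>y\<close> and \<open>z\<close>.\<close>
    define u v w where "u = dist y z" and "v = dist z x" and "w = dist x y"
    have uvw: "0 < u" "0 < v" "0 < w" using False by (auto simp: u_def v_def w_def)
    have tri: "u \<le> v + w" "v \<le> u + w" "w \<le> u + v"
      unfolding u_def v_def w_def using dist_triangle by (metis dist_commute add.commute)+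
    have T: "triple_kernel a1 a2 a3 x y z = u powr a1 * v powr a2 * w powr a3"
      by (simp add: triple_kernel_def u_def v_def w_def)
    have P: "?P = ennreal (w powr (a1 + a3)) * (ennreal (v powr a2) * indicator {..<2 * w} v)"
      and Q: "?Q = ennreal (v powr (a1 + a2)) * (ennreal (w powr a3) * indicator {..<2 * v} w)"
      and R: "?R = ennreal (w powr (a2 + a3)) * (ennreal (u powr a1) * indicator {..<2 * w} u)"
      by (simp_all add: pivot_kernel_def u_def v_def w_def dist_commute)
    consider "v \<le> w" "v \<le> u" | "w \<le> v" "w \<le> u" | "u \<le> w" "u \<le> v" by linarith
    then have "ennreal (triple_kernel a1 a2 a3 x y z) \<le> ennreal K * ?P
        \<or> ennreal (triple_kernel a1 a2 a3 x y z) \<le> ennreal K * ?Q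
        \<or> ennreal (triple_kernel a1 a2 a3 x y z) \<le> ennreal K * ?R"
    proof cases
      case 1
      have "u powr a1 \<le> A * w powr a1" using 1 tri uvw by (intro A(2)) auto
      also have "\<dots> \<le> K * w powr a1" using K by (intro mult_right_mono) auto
      finally have "u powr a1 * (v powr a2 * w powr a3) \<le> K * w powr a1 * (v powr a2 * w powr a3)"
        by (intro mult_right_mono) auto
      then have "ennreal (triple_kernel a1 a2 a3 x y z) \<le> ennreal (K * w powr a1 * (v powr a2 * w powr a3))"
        unfolding T by (intro ennreal_leI) (simp add: mult_ac)
      also have "\<dots> = ennreal K * ?P"
        unfolding P using 1 uvw K by (simp add: powr_add mult_ac flip: ennreal_mult'')
      finally show ?thesis by blast
    next
      case 2
      have "u powr a1 \<le> A * v powr a1" using 2 tri uvw by (intro A(2)) auto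
      also have "\<dots> \<le> K * v powr a1" using K by (intro mult_right_mono) auto
      finally have "u powr a1 * (v powr a2 * w powr a3) \<le> K * v powr a1 * (v powr a2 * w powr a3)"
        by (intro mult_right_mono) auto
      then have "ennreal (triple_kernel a1 a2 a3 x y z) \<le> ennreal (K * v powr a1 * (v powr a2 * w powr a3))"
        unfolding T by (intro ennreal_leI) (simp add: mult_ac)
      also have "\<dots> = ennreal K * ?Q"
        unfolding Q using 2 uvw K by (simp add: powr_add mult_ac flip: ennreal_mult'')
      finally show ?thesis by blast
    next
      case 3
      have "v powr a2 \<le> B * w powr a2" using 3 tri uvw by (intro B(2)) auto
      also have "\<dots> \<le> K * w powr a2" using K by (intro mult_right_mono) auto
      finally have "v powr a2 * (u powr a1 * w powr a3) \<le> K * w powr a2 * (u powr a1 * w powr a3)"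
        by (intro mult_right_mono) auto
      then have "ennreal (triple_kernel a1 a2 a3 x y z) \<le> ennreal (K * w powr a2 * (u powr a1 * w powr a3))"
        unfolding T by (intro ennreal_leI) (simp add: mult_ac)
      also have "\<dots> = ennreal K * ?R"
        unfolding R using 3 uvw K by (simp add: powr_add mult_ac flip: ennreal_mult'')
      finally show ?thesis by blast
    qed
    moreover have "ennreal K * ?P \<le> ennreal K * (?P + ?Q + ?R)"
      "ennreal K * ?Q \<le> ennreal K * (?P + ?Q + ?R)" "ennreal K * ?R \<le> ennreal K * (?P + ?Q + ?R)"
      by (intro mult_left_mono; simp add: add_increasing add_increasing2)+
    ultimately show ?thesis by (meson order_trans)
  qed
  have "triple_integral a1 a2 a3 \<le> (\<integral>\<^sup>+x. \<integral>\<^sup>+y. \<integral>\<^sup>+z. ennreal K * (pivot_kernel 2 a2 (a1 + a3) x y z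
      + pivot_kernel 2 a3 (a1 + a2) x z y + pivot_kernel 2 a1 (a2 + a3) y x z) \<partial>M \<partial>M \<partial>M)"
    unfolding triple_integral_def by (intro nn_integral_mono ptw)
  also have "\<dots> = ennreal K * (pivot_integral 2 a2 (a1 + a3)
      + (\<integral>\<^sup>+x. \<integral>\<^sup>+y. \<integral>\<^sup>+z. pivot_kernel 2 a3 (a1 + a2) x z y \<partial>M \<partial>M \<partial>M)
      + (\<integral>\<^sup>+x. \<integral>\<^sup>+y. \<integral>\<^sup>+z. pivot_kernel 2 a1 (a2 + a3) y x z \<partial>M \<partial>M \<partial>M))"
    unfolding pivot_integral_def by (simp add: nn_integral_cmult nn_integral_add cong: nn_integral_cong)
  also have "(\<integral>\<^sup>+x. \<integral>\<^sup>+y. \<integral>\<^sup>+z. pivot_kernel 2 a3 (a1 + a2) x z y \<partial>M \<partial>M \<partial>M) = pivot_integral 2 a3 (a1 + a2)"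
    unfolding pivot_integral_def by (rule nn_integral_swap23[symmetric]) measurable
  also have "(\<integral>\<^sup>+x. \<integral>\<^sup>+y. \<integral>\<^sup>+z. pivot_kernel 2 a1 (a2 + a3) y x z \<partial>M \<partial>M \<partial>M) = pivot_integral 2 a1 (a2 + a3)"
    unfolding pivot_integral_def by (rule nn_integral_swap12[symmetric]) measurable
  finally show ?thesis by (rule that)
qed

text \<open>
  Necessity of the conditions on the first and third exponent follows from the one on the second exponent by
  interchanging the variables; sufficiency is the finiteness of the three pivot integrals.
\<close>

theorem triple_integral_finite_iff:
  "triple_integral a1 a2 a3 < \<infinity> \<longleftrightarrow> - d < a1 \<and> - d < a2 \<and> - d < a3 \<and> - 2 * d < a1 + a2 + a3"
proof
  have nec: "- d < a2 \<and> - 2 * d < a1 + a2 + a3" if fin: "triple_integral a1 a2 a3 < \<infinity>" for a1 a2 a3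
  proof (rule ccontr)
    assume "\<not> ?thesis"
    then have "pivot_integral (1 / 2) a2 (a1 + a3) = \<infinity>"
      by (intro pivot_integral_eq_top) auto
    moreover obtain k where "0 < k" "ennreal k * pivot_integral (1 / 2) a2 (a1 + a3) \<le> triple_integral a1 a2 a3"
      using triple_integral_ge_pivot .
    ultimately show False using fin by (simp add: ennreal_mult_top top_unique)
  qed
  assume fin: "triple_integral a1 a2 a3 < \<infinity>"
  then show "- d < a1 \<and> - d < a2 \<and> - d < a3 \<and> - 2 * d < a1 + a2 + a3"
    using nec[OF fin] nec[of a2 a1 a3] nec[of a1 a3 a2] triple_integral_swap12[of a1 a2 a3]
      triple_integral_swap23[of a1 a2 a3] by simp
next
  assume *: "- d < a1 \<and> - d < a2 \<and> - d < a3 \<and> - 2 * d < a1 + a2 + a3"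
  obtain K where K: "triple_integral a1 a2 a3
    \<le> ennreal K * (pivot_integral 2 a2 (a1 + a3) + pivot_integral 2 a3 (a1 + a2) + pivot_integral 2 a1 (a2 + a3))"
    using triple_integral_le_pivot .
  have "pivot_integral 2 a2 (a1 + a3) < \<infinity>" "pivot_integral 2 a3 (a1 + a2) < \<infinity>"
    "pivot_integral 2 a1 (a2 + a3) < \<infinity>"
    using * by (intro pivot_integral_finite; simp)+
  then have "ennreal K * (pivot_integral 2 a2 (a1 + a3) + pivot_integral 2 a3 (a1 + a2) + pivot_integral 2 a1 (a2 + a3)) < \<infinity>"
    by (simp add: ennreal_mult_less_top)
  with K show "triple_integral a1 a2 a3 < \<infinity>" by (rule le_less_trans)
qed

lemma nn_integral_triple_kernel:
  "(\<integral>\<^sup>+w. ennreal (triple_kernel a1 a2 a3 (fst w) (fst (snd w)) (snd (snd w))) \<partial>(M \<Otimes>\<^sub>M (M \<Otimes>\<^sub>M M)))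
    = triple_integral a1 a2 a3"
proof -
  interpret P: pair_sigma_finite M M ..
  have "(\<lambda>w. ennreal (triple_kernel a1 a2 a3 (fst w) (fst (snd w)) (snd (snd w))))
      \<in> borel_measurable (M \<Otimes>\<^sub>M (M \<Otimes>\<^sub>M M))"
    by measurable
  then show ?thesis
    unfolding triple_integral_def
    by (subst sigma_finite_measure.nn_integral_fst[OF P.sigma_finite_measure_axioms, symmetric], simp)
       (auto intro!: nn_integral_cong simp flip: nn_integral_fst)
qed

text \<open>
  The same criterion for a function that is specified through its absolute value only, as needed for
  complex exponents.
\<close>

corollary integrable_iff_of_norm_eq_triple_kernel:
  fixes f :: "'a \<times> 'a \<times> 'a \<Rightarrow> 'b::{banach, second_countable_topology}"
  assumes "f \<in> borel_measurable (M \<Otimes>\<^sub>M (M \<Otimes>\<^sub>M M))"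
    and norm: "\<And>x y z. norm (f (x, y, z)) = triple_kernel a1 a2 a3 x y z"
  shows "integrable (M \<Otimes>\<^sub>M (M \<Otimes>\<^sub>M M)) f \<longleftrightarrow>
    - d < a1 \<and> - d < a2 \<and> - d < a3 \<and> - 2 * d < a1 + a2 + a3"
proof -
  have "(\<integral>\<^sup>+w. ennreal (norm (f w)) \<partial>(M \<Otimes>\<^sub>M (M \<Otimes>\<^sub>M M))) = triple_integral a1 a2 a3"
    unfolding nn_integral_triple_kernel[symmetric] by (intro nn_integral_cong) (auto simp: norm)
  then show ?thesis
    using assms(1) triple_integral_finite_iff[of a1 a2 a3] by (simp add: integrable_iff_bounded)
qed

end

section \<open>The surface measure of the sphere is Ahlfors regular\<close>

definition truncated_cone :: "'a::euclidean_space set \<Rightarrow> real \<Rightarrow> 'a set" where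
  "truncated_cone A t = {y. 0 < norm y \<and> norm y < t \<and> sgn y \<in> A}"

lemma truncated_cone_eq:
  assumes "A \<subseteq> sphere 0 1"
  shows "truncated_cone A t = {r *\<^sub>R x | r x. 0 < r \<and> r < t \<and> x \<in> A}"
proof (intro equalityI subsetI)
  fix y assume y: "y \<in> truncated_cone A t"
  then have "y = norm y *\<^sub>R sgn y" by (auto simp: truncated_cone_def sgn_div_norm)
  with y show "y \<in> {r *\<^sub>R x | r x. 0 < r \<and> r < t \<and> x \<in> A}"
    unfolding truncated_cone_def by blast
next
  fix y assume "y \<in> {r *\<^sub>R x | r x. 0 < r \<and> r < t \<and> x \<in> A}"
  then show "y \<in> truncated_cone A t"
    using assms by (force simp: truncated_cone_def sgn_div_norm)
qed

lemma sgn_borel_measurable: "(sgn :: 'a::euclidean_space \<Rightarrow> 'a) \<in> borel_measurable borel"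
proof -
  have "(\<lambda>x::'a. x /\<^sub>R norm x) \<in> borel_measurable borel" by measurable
  then show ?thesis by (simp add: sgn_div_norm[abs_def])
qed

lemma truncated_cone_borel [measurable]:
  assumes [measurable]: "A \<in> sets borel"
  shows "truncated_cone A t \<in> sets borel"
proof -
  note sgn_borel_measurable [measurable]
  show ?thesis unfolding truncated_cone_def by measurable
qed

lemma truncated_cone_scale:
  assumes "0 < t"
  shows "truncated_cone A t = (\<lambda>y. t *\<^sub>R y) ` truncated_cone A 1"
proof (intro equalityI subsetI)
  fix y assume y: "y \<in> truncated_cone A t"
  have "sgn (y /\<^sub>R t) = sgn y" using assms by (simp add: sgn_scaleR)
  with y have "y /\<^sub>R t \<in> truncated_cone A 1"
    using assms by (auto simp: truncated_cone_def field_simps)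
  then show "y \<in> (\<lambda>y. t *\<^sub>R y) ` truncated_cone A 1"
    using assms by (intro image_eqI[of _ _ "y /\<^sub>R t"]) auto
next
  fix y assume "y \<in> (\<lambda>y. t *\<^sub>R y) ` truncated_cone A 1"
  then show "y \<in> truncated_cone A t"
    using assms by (auto simp: truncated_cone_def sgn_scaleR)
qed

lemma measure_truncated_cone_scale:
  fixes A :: "'a::euclidean_space set"
  assumes A: "A \<in> sets borel" and t: "0 < t"
  shows "measure lborel (truncated_cone A t) = t ^ DIM('a) * measure lborel (truncated_cone A 1)"
proof -
  have "measure lebesgue (truncated_cone A t) = t ^ DIM('a) * measure lebesgue (truncated_cone A 1)"
    using measure_lebesgue_affine[of t 0 "truncated_cone A 1"] t truncated_cone_scale[OF t, of A]
    by simp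
  then show ?thesis using truncated_cone_borel[OF A] by (simp add: measure_completion)
qed

lemma emeasure_truncated_cone_finite:
  fixes A :: "'a::euclidean_space set"
  shows "emeasure lborel (truncated_cone A t) < \<infinity>"
proof -
  have "emeasure lborel (truncated_cone A t) \<le> emeasure lborel (ball (0::'a) t)"
    by (intro emeasure_mono) (auto simp: truncated_cone_def)
  then show ?thesis using emeasure_lborel_ball_finite le_less_trans by blast
qed

lemma measure_sphere_measure:
  fixes A :: "'a::euclidean_space set"
  assumes "A \<in> sets borel" "A \<subseteq> sphere 0 1"
  shows "measure sphere_measure A = DIM('a) * measure lborel (truncated_cone A 1)"
  using emeasure_sphere_measure[OF assms] truncated_cone_eq[OF assms(2), of 1]
  by (simp add: measure_def enn2real_mult)

text \<open>
  Subtracting a cone from its dilation by \<open>1 + r\<close> leaves the radial thickening of \<open>A\<close>, and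
  turns the comparison of its volume with the measure of \<open>A\<close> into an estimate of \<open>(1 + r)\<close> to the \<open>n\<close>, minus 1.
\<close>

lemma measure_cone_annulus:
  fixes A :: "'a::euclidean_space set"
  assumes A: "A \<in> sets borel" and r: "0 < r"
  shows "measure lborel (truncated_cone A (1 + r) - truncated_cone A 1)
    = ((1 + r) ^ DIM('a) - 1) * measure lborel (truncated_cone A 1)"
proof -
  have "measure lborel (truncated_cone A (1 + r) - truncated_cone A 1)
      = measure lborel (truncated_cone A (1 + r)) - measure lborel (truncated_cone A 1)"
    using emeasure_truncated_cone_finite[of A "1 + r"] truncated_cone_borel[OF A] r
    by (intro measure_Diff) (auto simp: truncated_cone_def)
  then show ?thesis
    using measure_truncated_cone_scale[OF A, of "1 + r"] r by (simp add: algebra_simps)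
qed

lemma norm_diff_sgn:
  fixes y :: "'a::real_normed_vector"
  assumes "y \<noteq> 0"
  shows "norm (y - sgn y) = \<bar>norm y - 1\<bar>"
proof -
  have "norm y *\<^sub>R sgn y = y" using assms by (simp add: sgn_div_norm)
  then have "y - sgn y = (norm y - 1) *\<^sub>R sgn y" by (simp add: scaleR_diff_left)
  then show ?thesis using assms by (simp add: norm_sgn)
qed

text \<open>
  A point of the thickened cap is closer than \<open>r\<close> to its radial projection, which is closer than \<open>r\<close> to \<open>x\<close>.
\<close>

lemma cap_annulus_subset_ball:
  fixes x :: "'a::euclidean_space"
  assumes r: "0 < r"
  shows "truncated_cone {z \<in> sphere 0 1. dist x z < r} (1 + r) - truncated_cone {z \<in> sphere 0 1. dist x z < r} 1
    \<subseteq> ball x (2 * r)"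
proof
  fix y assume "y \<in> truncated_cone {z \<in> sphere 0 1. dist x z < r} (1 + r)
      - truncated_cone {z \<in> sphere 0 1. dist x z < r} 1"
  then have y: "1 \<le> norm y" "norm y < 1 + r" "dist x (sgn y) < r"
    by (auto simp: truncated_cone_def)
  then have "y \<noteq> 0" by auto
  with y have "dist (sgn y) y < r" using norm_diff_sgn[of y] by (auto simp: dist_norm norm_minus_commute)
  with y dist_triangle[of x y "sgn y"] show "y \<in> ball x (2 * r)" by simp
qed

text \<open>
  With \<open>t = 1 + r / 2\<close>, each point \<open>y\<close> of the ball has \<open>|y|\<close> closer than \<open>r / 2\<close> to \<open>t\<close>, so its projection to the sphere of
  radius \<open>t\<close> is closer than \<open>r / 2 + r / 2\<close> to \<open>t x\<close>; going back to the unit sphere shrinks distances as \<open>t \<ge> 1\<close>.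
\<close>

lemma ball_subset_cap_annulus:
  fixes x :: "'a::euclidean_space"
  assumes x: "norm x = 1" and r: "0 < r"
  shows "ball ((1 + r / 2) *\<^sub>R x) (r / 2)
    \<subseteq> truncated_cone {z \<in> sphere 0 1. dist x z < r} (1 + r) - truncated_cone {z \<in> sphere 0 1. dist x z < r} 1"
proof
  define t where "t = 1 + r / 2"
  have t: "1 \<le> t" "norm (t *\<^sub>R x) = t" using r x by (auto simp: t_def)
  fix y assume "y \<in> ball ((1 + r / 2) *\<^sub>R x) (r / 2)"
  then have y: "norm (t *\<^sub>R x - y) < r / 2" by (simp add: dist_norm t_def)
  then have ny: "\<bar>t - norm y\<bar> < r / 2" using norm_triangle_ineq3[of "t *\<^sub>R x" y] t by simp
  then have y1: "1 < norm y" "norm y < 1 + r" unfolding t_def by linarith+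
  have "norm y *\<^sub>R sgn y = y" using y1 by (cases "y = 0") (auto simp: sgn_div_norm)
  then have "t *\<^sub>R x - t *\<^sub>R sgn y = (t *\<^sub>R x - y) + (norm y - t) *\<^sub>R sgn y"
    by (simp add: scaleR_diff_left)
  also have "norm \<dots> \<le> norm (t *\<^sub>R x - y) + \<bar>norm y - t\<bar>"
    using y1 norm_triangle_ineq[of "t *\<^sub>R x - y" "(norm y - t) *\<^sub>R sgn y"]
    by (auto simp: norm_sgn split: if_splits)
  also have "\<dots> < r" using y ny by linarith
  finally have "t * dist x (sgn y) < r"
    using t by (simp add: dist_norm flip: scaleR_diff_right)
  moreover have "1 * dist x (sgn y) \<le> t * dist x (sgn y)" using t by (intro mult_right_mono) auto
  ultimately have "dist x (sgn y) < r" by linarith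
  with y1 show "y \<in> truncated_cone {z \<in> sphere 0 1. dist x z < r} (1 + r)
      - truncated_cone {z \<in> sphere 0 1. dist x z < r} 1"
    by (auto simp: truncated_cone_def norm_sgn)
qed

lemma power_diff_1_lower:
  fixes r :: real
  assumes "0 \<le> r"
  shows "real n * r \<le> (1 + r) ^ n - 1"
proof -
  have "(\<Sum>i<n. 1) \<le> (\<Sum>i<n. (1 + r) ^ i)" using assms by (intro sum_mono) auto
  then have "r * real n \<le> r * (\<Sum>i<n. (1 + r) ^ i)" using assms by (intro mult_left_mono) auto
  then show ?thesis using power_diff_1_eq[of "1 + r" n] by (simp add: mult.commute)
qed

text \<open>
  All powers in the geometric sum are at most \<open>3 ^ n\<close>; together with the radius \<open>r / 2\<close> of the inscribed
  ball this is the origin of the constant \<open>6 ^ n\<close> in the lower bound for caps.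
\<close>

lemma power_diff_1_upper:
  fixes r :: real
  assumes r: "0 \<le> r" "r \<le> 2"
  shows "(1 + r) ^ n - 1 \<le> real n * 3 ^ n * r"
proof -
  have "(\<Sum>i<n. (1 + r) ^ i) \<le> (\<Sum>i<n. 3 ^ n)"
  proof (intro sum_mono)
    fix i assume i: "i \<in> {..<n}"
    have "(1 + r) ^ i \<le> 3 ^ i" using r by (intro power_mono) auto
    also have "\<dots> \<le> (3 :: real) ^ n" using i by (intro power_increasing) auto
    finally show "(1 + r) ^ i \<le> 3 ^ n" .
  qed
  then have "r * (\<Sum>i<n. (1 + r) ^ i) \<le> r * (real n * 3 ^ n)" using r by (intro mult_left_mono) auto
  then show ?thesis using power_diff_1_eq[of "1 + r" n] by (simp add: mult_ac)
qed

lemma cap_borel: "{z \<in> sphere 0 1. dist x z < r} \<in> sets (borel :: 'a::euclidean_space measure)"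
proof -
  have "{z \<in> sphere 0 1. dist x z < r} = sphere 0 1 \<inter> ball x r" by auto
  then show ?thesis by simp
qed

lemma sphere_measure_cap_upper:
  fixes x :: "'a::euclidean_space"
  assumes r: "0 < r"
  shows "measure sphere_measure {z \<in> sphere 0 1. dist x z < r}
    \<le> unit_ball_vol DIM('a) * 2 ^ DIM('a) * r powr (real DIM('a) - 1)"
proof -
  let ?A = "{z \<in> sphere 0 1. dist x z < r}"
  let ?m = "measure lborel (truncated_cone ?A 1)"
  have "DIM('a) * r * ?m \<le> ((1 + r) ^ DIM('a) - 1) * ?m"
    using r by (intro mult_right_mono power_diff_1_lower) auto
  also have "\<dots> = measure lborel (truncated_cone ?A (1 + r) - truncated_cone ?A 1)"
    by (rule measure_cone_annulus[symmetric, OF cap_borel r])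
  also have "\<dots> \<le> measure lborel (ball x (2 * r))"
    using truncated_cone_borel[OF cap_borel] emeasure_lborel_ball_finite
    by (intro measure_mono_fmeasurable cap_annulus_subset_ball r) (auto simp: fmeasurable_def)
  also have "\<dots> = unit_ball_vol DIM('a) * 2 ^ DIM('a) * r ^ DIM('a)"
    using r by (simp add: content_ball power_mult_distrib)
  finally have "DIM('a) * ?m * r \<le> unit_ball_vol DIM('a) * 2 ^ DIM('a) * r powr (real DIM('a) - 1) * r"
    using r by (simp add: powr_diff powr_realpow mult_ac)
  then show ?thesis using r by (subst measure_sphere_measure[OF cap_borel]) auto
qed

lemma sphere_measure_cap_lower:
  fixes x :: "'a::euclidean_space"
  assumes x: "x \<in> sphere 0 1" and r: "0 < r" "r \<le> 2"
  shows "unit_ball_vol DIM('a) / 6 ^ DIM('a) * r powr (real DIM('a) - 1)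
    \<le> measure sphere_measure {z \<in> sphere 0 1. dist x z < r}"
proof -
  let ?A = "{z \<in> sphere 0 1. dist x z < r}"
  let ?m = "measure lborel (truncated_cone ?A 1)"
  have "unit_ball_vol DIM('a) * (r / 2) ^ DIM('a) = measure lborel (ball ((1 + r / 2) *\<^sub>R x) (r / 2))"
    using r by (simp add: content_ball)
  also have "\<dots> \<le> measure lborel (truncated_cone ?A (1 + r) - truncated_cone ?A 1)"
  proof (intro measure_mono_fmeasurable ball_subset_cap_annulus)
    have "truncated_cone ?A (1 + r) - truncated_cone ?A 1 \<subseteq> ball x (2 * r)"
      by (rule cap_annulus_subset_ball[OF r(1)])
    then have "emeasure lborel (truncated_cone ?A (1 + r) - truncated_cone ?A 1) \<le> emeasure lborel (ball x (2 * r))"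
      by (intro emeasure_mono) auto
    then show "truncated_cone ?A (1 + r) - truncated_cone ?A 1 \<in> fmeasurable lborel"
      using truncated_cone_borel[OF cap_borel] emeasure_lborel_ball_finite[of x "2 * r"]
      by (auto simp: fmeasurable_def intro: le_less_trans)
  qed (use x r in auto)
  also have "\<dots> = ((1 + r) ^ DIM('a) - 1) * ?m"
    by (rule measure_cone_annulus[OF cap_borel r(1)])
  also have "\<dots> \<le> real DIM('a) * 3 ^ DIM('a) * r * ?m"
    using r by (intro mult_right_mono power_diff_1_upper) auto
  finally have "unit_ball_vol DIM('a) * (r / 2) ^ DIM('a) \<le> DIM('a) * ?m * r * 3 ^ DIM('a)"
    by (simp add: mult_ac)
  then have le: "unit_ball_vol DIM('a) * (r / 2) ^ DIM('a) / 3 ^ DIM('a) \<le> DIM('a) * ?m * r"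
    by (simp add: divide_le_eq)
  have eq: "unit_ball_vol DIM('a) * (r / 2) ^ DIM('a) / 3 ^ DIM('a)
      = unit_ball_vol DIM('a) / 6 ^ DIM('a) * r powr (real DIM('a) - 1) * r"
    using r by (simp add: powr_diff powr_realpow power_divide flip: power_mult_distrib)
  have "unit_ball_vol DIM('a) / 6 ^ DIM('a) * r powr (real DIM('a) - 1) \<le> DIM('a) * ?m"
    using le[unfolded eq] r(1) by (rule mult_right_le_imp_le)
  then show ?thesis by (subst measure_sphere_measure[OF cap_borel]) auto
qed

lemma ahlfors_regular_sphere_measure:
  assumes "2 \<le> DIM('a::euclidean_space)"
  shows "ahlfors_regular (sphere_measure :: 'a measure)
    (unit_ball_vol DIM('a) / 6 ^ DIM('a)) (unit_ball_vol DIM('a) * 2 ^ DIM('a)) (real DIM('a) - 1) 2"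
proof (intro ahlfors_regular.intro ahlfors_regular_axioms.intro finite_measureI)
  have "emeasure sphere_measure (sphere 0 1 :: 'a set)
      = of_nat DIM('a) * emeasure lborel (truncated_cone (sphere 0 1 :: 'a set) 1)"
    by (subst truncated_cone_eq[OF order_refl], rule emeasure_sphere_measure) auto
  also have "\<dots> \<noteq> \<infinity>"
    using emeasure_truncated_cone_finite[of "sphere 0 1 :: 'a set" 1]
    by (auto simp: ennreal_mult_eq_top_iff)
  finally have "emeasure sphere_measure (sphere 0 1 :: 'a set) \<noteq> \<infinity>" .
  then show "emeasure (sphere_measure :: 'a measure) (space sphere_measure) \<noteq> \<infinity>" by simp
  have "(\<lambda>x::'a. x) \<in> borel_measurable (restrict_space borel (sphere 0 1))"
    by (intro measurable_restrict_space1) simp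
  then show "(\<lambda>x::'a. x) \<in> borel_measurable sphere_measure"
    by (simp cong: measurable_cong_sets)
  show "space (sphere_measure :: 'a measure) \<noteq> {}" by simp
  fix x y :: 'a assume "x \<in> space sphere_measure" "y \<in> space sphere_measure"
  then show "dist x y \<le> 2" using norm_triangle_ineq4[of x y] by (simp add: dist_norm)
qed (use assms sphere_measure_cap_upper sphere_measure_cap_lower in auto)

section \<open>Integrability of the kernel on the sphere\<close>

text \<open>
  On the nonnegative reals the complex power reduces to the real logarithm, so that the branch cut of the complex
  one does not enter.
\<close>

lemma complex_powr_measurable:
  assumes [measurable]: "f \<in> borel_measurable N" and "\<And>w. 0 \<le> f w"
  shows "(\<lambda>w. complex_of_real (f w) powr s) \<in> borel_measurable N"
proof -
  have "complex_of_real (f w) powr s = (if f w = 0 then 0 else exp (s * complex_of_real (ln (f w))))" for w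
    using assms(2)[of w] by (auto simp: powr_def Ln_of_real)
  then show ?thesis by simp
qed

lemma norm_sphere_kernel:
  fixes x y z :: "'a::euclidean_space"
  defines "\<rho> \<equiv> sphere_rho TYPE('a)"
  shows "norm (sphere_kernel \<alpha> x y z)
    = triple_kernel (- \<rho> + Re (\<alpha> $ 1)) (- \<rho> + Re (\<alpha> $ 2)) (- \<rho> + Re (\<alpha> $ 3)) x y z"
  by (simp add: sphere_kernel_def triple_kernel_def Let_def norm_mult norm_powr_real_powr dist_norm \<rho>_def)

theorem theorem2p2:
  fixes \<alpha> :: "complex ^ 3"
  assumes "CARD('n::finite) \<ge> 3"
  shows "integrable (sphere_measure \<Otimes>\<^sub>M (sphere_measure \<Otimes>\<^sub>M sphere_measure))
           (\<lambda>(x\<^sub>1 :: real ^ 'n, x\<^sub>2, x\<^sub>3). sphere_kernel \<alpha> x\<^sub>1 x\<^sub>2 x\<^sub>3)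
         \<longleftrightarrow> (\<forall>j. Re (\<alpha> $ j) > - sphere_rho TYPE(real ^ 'n)) \<and>
             Re (\<alpha> $ 1) + Re (\<alpha> $ 2) + Re (\<alpha> $ 3) > - sphere_rho TYPE(real ^ 'n)"
proof -
  define \<rho> where "\<rho> = sphere_rho TYPE(real ^ 'n)"
  let ?S = "sphere_measure :: (real ^ 'n) measure"
  let ?K = "\<lambda>(x\<^sub>1 :: real ^ 'n, x\<^sub>2, x\<^sub>3). sphere_kernel \<alpha> x\<^sub>1 x\<^sub>2 x\<^sub>3"
  have reg: "ahlfors_regular ?S (unit_ball_vol DIM(real ^ 'n) / 6 ^ DIM(real ^ 'n))
    (unit_ball_vol DIM(real ^ 'n) * 2 ^ DIM(real ^ 'n)) (real DIM(real ^ 'n) - 1) 2"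
    by (rule ahlfors_regular_sphere_measure) (use assms in simp)
  have d: "real DIM(real ^ 'n) - 1 = 2 * \<rho>" by (simp add: \<rho>_def sphere_rho_def)
  have "(\<lambda>w. sphere_kernel \<alpha> (fst w) (fst (snd w)) (snd (snd w)))
      \<in> borel_measurable (?S \<Otimes>\<^sub>M (?S \<Otimes>\<^sub>M ?S))"
    unfolding sphere_kernel_def Let_def dist_norm[symmetric]
    by (intro borel_measurable_times complex_powr_measurable ahlfors_regular.dist_measurable[OF reg]) auto
  then have meas: "?K \<in> borel_measurable (?S \<Otimes>\<^sub>M (?S \<Otimes>\<^sub>M ?S))" by (simp add: case_prod_beta')
  have "integrable (?S \<Otimes>\<^sub>M (?S \<Otimes>\<^sub>M ?S)) ?K \<longleftrightarrow>
      (\<forall>j. - (2 * \<rho>) < - \<rho> + Re (\<alpha> $ j)) \<and>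
      - 2 * (2 * \<rho>) < (- \<rho> + Re (\<alpha> $ 1)) + (- \<rho> + Re (\<alpha> $ 2)) + (- \<rho> + Re (\<alpha> $ 3))"
    using ahlfors_regular.integrable_iff_of_norm_eq_triple_kernel[OF reg meas,
        of "- \<rho> + Re (\<alpha> $ 1)" "- \<rho> + Re (\<alpha> $ 2)" "- \<rho> + Re (\<alpha> $ 3)"]
    unfolding d forall_3 by (simp add: norm_sphere_kernel \<rho>_def)
  also have "\<dots> \<longleftrightarrow> (\<forall>j. Re (\<alpha> $ j) > - \<rho>) \<and> Re (\<alpha> $ 1) + Re (\<alpha> $ 2) + Re (\<alpha> $ 3) > - \<rho>"
    unfolding forall_3 by auto
  finally show ?thesis by (simp add: \<rho>_def)
qed

end
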